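(* Let $\mathcal{P}$ be an increasing sequence of positive real numbers such that (P1) $\mathcal{P}\cap[0,1)=\varnothing$ and (P2) the series $\sum_{p\in\mathcal{P}}\frac{1}{p^{\sigma}}$ has abscissa of convergence equal to $1$. Let $(X_p)_{p\in\mathcal{P}}$ be i.i.d. random variables with $\mathbb{P}(X_p=1)=\mathbb{P}(X_p=-1)=1/2$, and let $F(\sigma)=\sum_{p\in\mathcal{P}}\frac{X_p}{p^{\sigma}}$. (i) If $\sum_{p\in\mathcal{P}}\frac{1}{p}<\infty$, then with positive probability $F$ has no real zeros. (ii) If $\sum_{p\in\mathcal{P}}\frac{1}{p}=\infty$, then almost surely $F$ has an infinite number of real zeros.
   Context: The elements of $\mathcal{P}$ are listed as $p_1<p_2<\cdots$, and sums over $p\in\mathcal{P}$ are taken in this increasing order. The abscissa of convergence of a Dirichlet series $\sum_{p\in\mathcal{P}}a_p p^{-\sigma}$ is the smallest number $\sigma_c$ such that the series converges for all real $\sigma>\sigma_c$. Under (P1)-(P2) the random series $F(\sigma)$ has almost surely abscissa of convergence $1/2$. A real zero of $F$ is a real number $\sigma$ at which the series $F(\sigma)$ converges and has sum $0$. *)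

theory Defs
  imports "HOL-Probability.Probability"
begin

text \<open>
  An infinite sequence \<open>p\<close> of positive reals, together with coefficients \<open>a\<close>, gives the generalised
  Dirichlet series with terms \<open>a n * p n powr (- s)\<close>.  Series are summed in the order of the index,
  so \<open>summable\<close> and \<open>sums\<close> express conditional convergence.
\<close>

definition dirichlet_term :: "(nat \<Rightarrow> real) \<Rightarrow> (nat \<Rightarrow> real) \<Rightarrow> real \<Rightarrow> nat \<Rightarrow> real" where
  "dirichlet_term p a s n = a n / p n powr s"

text \<open>
  A relation rather than a function, because a series that converges everywhere or nowhere has no
  real abscissa.
\<close>

definition has_abscissa_of_convergence ::
    "(nat \<Rightarrow> real) \<Rightarrow> (nat \<Rightarrow> real) \<Rightarrow> real \<Rightarrow> bool" where
  "has_abscissa_of_convergence p a c \<longleftrightarrow>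
     (\<forall>s>c. summable (dirichlet_term p a s)) \<and>
     (\<forall>c'. (\<forall>s>c'. summable (dirichlet_term p a s)) \<longrightarrow> c \<le> c')"

definition real_zeros :: "(nat \<Rightarrow> real) \<Rightarrow> (nat \<Rightarrow> real) \<Rightarrow> real set" where
  "real_zeros p a = {s. dirichlet_term p a s sums 0}"

end

theory Submission
  imports Defs
begin

text \<open>
  Replace \<open>X\<close> by signs \<open>e\<close> that are \<open>1\<close> or \<open>- 1\<close> everywhere.  Kolmogorov's maximal inequality shows
  that \<open>\<Sum>n. a n * e n\<close> converges almost surely if \<open>\<Sum>n. (a n)\<^sup>2\<close> does.  Conversely, a comparison of
  second and fourth moments shows that \<open>\<Sum>n. a n * e n\<close> exceeds a fifth of its standard deviation with
  probability at least \<open>1 / 16\<close>, so by the zero-one law a family of such sums whose variances tend to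
  infinity is almost surely unbounded above, and by symmetry also below.

  (i) To the left of \<open>1 / 2\<close> the series diverges almost surely.  With positive probability the first \<open>N\<close>
  signs are \<open>1\<close> while all partial sums of the tail at \<open>1 / 2\<close> are small, and by Abel summation the head
  then dominates the tail at every \<open>\<sigma> \<ge> 1 / 2\<close>.

  (ii) The variance of \<open>F \<sigma>\<close> tends to infinity as \<open>\<sigma>\<close> decreases to \<open>1 / 2\<close>, so \<open>F\<close> takes both
  signs arbitrarily close to \<open>1 / 2\<close>, and the intermediate value theorem produces the zeros.
\<close>

section \<open>Elementary inequalities and events that occur infinitely often\<close>

text \<open>
  For a variable with mean \<open>0\<close>, second moment \<open>1\<close> and fourth moment at most \<open>3\<close>, the left-hand side has
  expectation at least \<open>1 / 4\<close>.
\<close>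

lemma quartic_minorant:
  fixes y :: real
  shows "y + y^2 - y^4 / 6 - 1 / 4 \<le> 4 * indicator {1 / 5<..} y"
proof -
  \<comment> \<open>Replaces \<open>y^4\<close> by its tangent in \<open>y^2\<close> at
    \<open>y^2 = t\<close>, so every range needs only a quadratic estimate. With
    \<open>t = 3\<close> the squares cancel and \<open>y + 5/4\<close> is left, whence the break
    point \<open>- 5/4\<close>.\<close>
  have t: "y^4 \<ge> 2 * t * y^2 - t^2" for t :: real
    using zero_le_power2[of "y^2 - t"] by (simp add: power2_diff algebra_simps flip: power_mult)
  consider "y \<le> - 5/4" | "- 5/4 \<le> y" "y \<le> -1" | "-1 \<le> y" "y \<le> 0" | "0 \<le> y" "y \<le> 1 / 5"
    | "1 / 5 < y" "y \<le> 2" | "2 < y"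
    by linarith
  then show ?thesis
  proof cases
    case 1
    then show ?thesis using t[of 3] by simp
  next
    case 2
    then have "(y + 5/4) * (y + 1) \<le> 0"
      by (intro mult_nonneg_nonpos) auto
    then show ?thesis using t[of "9/5"] 2 by (simp add: power2_eq_square field_simps)
  next
    case 3
    then have "y * (y + 1) \<le> 0"
      by (intro mult_nonpos_nonneg) auto
    then have "y + y^2 \<le> 0"
      by (simp add: power2_eq_square algebra_simps)
    moreover have "y^4 \<ge> 0" by simp
    ultimately have "y + y^2 - y^4 / 6 - 1 / 4 \<le> 0" by linarith
    then show ?thesis by (rule order.trans) simp
  next
    case 4
    then have "y * y \<le> (1 / 5) * (1 / 5)"
      by (intro mult_mono) auto
    then have "y^2 \<le> 1 / 25"
      by (simp add: power2_eq_square)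
    moreover have "y^4 \<ge> 0" by simp
    ultimately have "y + y^2 - y^4 / 6 - 1 / 4 \<le> 0" using 4 by linarith
    then show ?thesis by (rule order.trans) simp
  next
    case 5
    then show ?thesis using t[of 3] by simp
  next
    case 6
    then have "y * y \<ge> 2 * y"
      by (intro mult_right_mono) auto
    then have "y^2 \<ge> 2 * y"
      by (simp only: power2_eq_square)
    moreover have "y^4 \<ge> 12 * y^2 - 36" using t[of 6] by simp
    ultimately have "y + y^2 - y^4 / 6 - 1 / 4 \<le> 4" using 6 by linarith
    then show ?thesis using 6 by simp
  qed
qed

text \<open>Summation by parts puts the weights \<open>w m\<close> and
  \<open>w i - w (Suc i)\<close> on the partial sums of \<open>b\<close>; they are nonnegative and
  telescope to \<open>w 0\<close>.\<close>

lemma abel_bound: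
  fixes b w :: "nat \<Rightarrow> real"
  assumes b: "\<And>m. \<bar>\<Sum>i<m. b i\<bar> \<le> c" and w: "\<And>i. w (Suc i) \<le> w i" "\<And>i. 0 \<le> w i"
  shows "\<bar>\<Sum>i<m. b i * w i\<bar> \<le> c * w 0"
proof -
  define B where "B m = (\<Sum>i<m. b i)" for m
  have eq: "(\<Sum>i<m. b i * w i) = B m * w m + (\<Sum>i<m. B (Suc i) * (w i - w (Suc i)))"
    by (induction m) (auto simp: B_def algebra_simps)
  have "\<bar>B m * w m\<bar> \<le> c * w m"
    using b[of m] w(2)[of m] by (auto simp: B_def abs_mult intro: mult_right_mono)
  moreover have "\<bar>\<Sum>i<m. B (Suc i) * (w i - w (Suc i))\<bar> \<le> (\<Sum>i<m. c * (w i - w (Suc i)))"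
  proof (intro order.trans[OF sum_abs] sum_mono)
    show "\<bar>B (Suc i) * (w i - w (Suc i))\<bar> \<le> c * (w i - w (Suc i))" for i
      using b[of "Suc i"] w(1)[of i] unfolding abs_mult B_def by (intro mult_mono) auto
  qed
  moreover have "(\<Sum>i<m. c * (w i - w (Suc i))) = c * (w 0 - w m)"
    by (simp add: sum_lessThan_telescope' flip: sum_distrib_left)
  ultimately show ?thesis
    unfolding eq by (simp add: algebra_simps abs_le_iff)
qed

text \<open>The event is the decreasing intersection of the unions \<open>B m\<close>. Each of them
  contains some \<open>A n\<close> of probability at least \<open>r\<close>, and continuity from
  above keeps the bound.\<close>

lemma (in prob_space) prob_limsup_ge:
  assumes A: "\<And>n. A n \<in> events" and r: "\<forall>\<^sub>F n in sequentially. r \<le> prob (A n)"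
  shows "r \<le> prob {\<omega> \<in> space M. \<exists>\<^sub>\<infinity>n. \<omega> \<in> A n}"
proof -
  define B where "B m = (\<Union>n\<in>{m..}. A n)" for m
  have BM: "range B \<subseteq> events" unfolding B_def using A by auto
  have "(\<lambda>m. prob (B m)) \<longlonglongrightarrow> prob (\<Inter>m. B m)"
    by (rule finite_Lim_measure_decseq[OF BM]) (force simp: decseq_def B_def)
  moreover have "(\<Inter>m. B m) = {\<omega> \<in> space M. \<exists>\<^sub>\<infinity>n. \<omega> \<in> A n}"
    unfolding B_def INFM_nat_le using A[THEN sets.sets_into_space] by blast
  moreover have "r \<le> prob (B m)" for m
  proof -
    obtain n where "n \<ge> m" "r \<le> prob (A n)"
      using r unfolding eventually_sequentially by (meson le_cases order_refl)
    moreover have "prob (A n) \<le> prob (B m)"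
      using \<open>n \<ge> m\<close> BM by (intro finite_measure_mono) (auto simp: B_def)
    ultimately show ?thesis by linarith
  qed
  ultimately show ?thesis
    by (intro LIMSEQ_le_const[of "\<lambda>m. prob (B m)"]) auto
qed

section \<open>Generalised Dirichlet series with fixed coefficients\<close>

lemma inverse_powr_square: "(1 / y powr s)\<^sup>2 = 1 / y powr (2 * s)" for y s :: real
  by (simp add: power_divide power2_eq_square flip: powr_add)

text \<open>Abel summation with the weights \<open>p (N + i) powr (s - t)\<close>, which do not
  increase because \<open>s \<le> t\<close>. The factor \<open>p N powr (s - t)\<close> allows a
  comparison with the first term of the series at every \<open>t\<close>.\<close>

lemma dirichlet_tail_bound:
  assumes p: "\<And>n. p n > 0" "mono p" and st: "s \<le> t"
    and c: "\<And>m. \<bar>\<Sum>i<m. dirichlet_term p x s (N + i)\<bar> \<le> c"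
  shows "\<bar>\<Sum>i<m. dirichlet_term p x t (N + i)\<bar> \<le> c * p N powr (s - t)"
proof -
  have "\<bar>\<Sum>i<m. dirichlet_term p x s (N + i) * p (N + i) powr (s - t)\<bar> \<le> c * p (N + 0) powr (s - t)"
  proof (rule abel_bound[OF c])
    show "p (N + Suc i) powr (s - t) \<le> p (N + i) powr (s - t)" for i
      using p st by (intro powr_mono2') (auto simp: monoD)
  qed simp
  moreover have "dirichlet_term p x s n * p n powr (s - t) = dirichlet_term p x t n" for n
    using p(1)[of n] by (simp add: dirichlet_term_def powr_diff)
  ultimately show ?thesis by simp
qed

text \<open>Since \<open>p n \<ge> 1\<close>, the factor gained on moving from \<open>s\<close> to
  \<open>t\<close> is at most \<open>1\<close>, so one Cauchy estimate at \<open>s\<close> serves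
  all \<open>t \<ge> s\<close>.\<close>

lemma dirichlet_uniformly_convergent:
  assumes p: "\<And>n. p n \<ge> 1" "mono p" and s: "summable (dirichlet_term p x s)"
  shows "uniformly_convergent_on {s..} (\<lambda>m t. \<Sum>i<m. dirichlet_term p x t i)"
proof (rule Cauchy_uniformly_convergent, rule uniformly_Cauchy_onI')
  fix r :: real assume r: "r > 0"
  obtain N where N: "\<And>m n. m \<ge> N \<Longrightarrow> \<bar>\<Sum>i\<in>{m..<n}. dirichlet_term p x s i\<bar> < r / 2"
    using s r unfolding summable_Cauchy by (metis half_gt_zero real_norm_def)
  have shift: "(\<Sum>i<q. dirichlet_term p x t (m + i)) = (\<Sum>i\<in>{m..<m + q}. dirichlet_term p x t i)" for m q t
    using sum.shift_bounds_nat_ivl[of "dirichlet_term p x t" 0 m q]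
    by (simp add: add.commute lessThan_atLeast0)
  have "dist (\<Sum>i<m. dirichlet_term p x t i) (\<Sum>i<n. dirichlet_term p x t i) < r"
    if t: "t \<in> {s..}" and m: "m \<ge> N" and n: "m < n" for t m n
  proof -
    have "\<bar>\<Sum>i<n - m. dirichlet_term p x t (m + i)\<bar> \<le> r / 2 * p m powr (s - t)"
    proof (rule dirichlet_tail_bound)
      show "p n > 0" for n using p(1)[of n] by linarith
      show "\<bar>\<Sum>i<q. dirichlet_term p x s (m + i)\<bar> \<le> r / 2" for q
        using N[OF m, of "m + q"] by (simp add: shift)
    qed (use p t in auto)
    also have "\<dots> \<le> r / 2 * 1"
      using r t p(1)[of m] powr_mono[of "s - t" 0 "p m"] by (intro mult_left_mono) auto
    also have "(\<Sum>i<n - m. dirichlet_term p x t (m + i)) = (\<Sum>i<n. dirichlet_term p x t i) - (\<Sum>i<m. dirichlet_term p x t i)"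
      unfolding shift using n sum_diff_nat_ivl[of 0 m n "dirichlet_term p x t"]
      by (simp add: lessThan_atLeast0)
    finally show ?thesis
      using r by (simp add: dist_real_def abs_minus_commute)
  qed
  then show "\<exists>M. \<forall>t\<in>{s..}. \<forall>m\<ge>M. \<forall>n>m. dist (\<Sum>i<m. dirichlet_term p x t i) (\<Sum>i<n. dirichlet_term p x t i) < r"
    by blast
qed

lemma dirichlet_summable_mono:
  assumes "\<And>n. p n \<ge> 1" "mono p" "summable (dirichlet_term p x s)" "s \<le> t"
  shows "summable (dirichlet_term p x t)"
  using uniformly_convergent_imp_convergent[OF dirichlet_uniformly_convergent[OF assms(1-3)], of t] assms(4)
  by (simp add: summable_iff_convergent)

lemma dirichlet_continuous_on:
  assumes "\<And>n. p n \<ge> 1" "mono p" "summable (dirichlet_term p x s)"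
  shows "continuous_on {s..} (\<lambda>t. \<Sum>n. dirichlet_term p x t n)"
proof (rule uniform_limit_theorem)
  show "uniform_limit {s..} (\<lambda>m t. \<Sum>i<m. dirichlet_term p x t i) (\<lambda>t. \<Sum>n. dirichlet_term p x t n) sequentially"
    using dirichlet_uniformly_convergent[OF assms]
    by (simp add: uniformly_convergent_uniform_limit_iff suminf_eq_lim)
  have "p n > 0" for n using assms(1)[of n] by linarith
  then show "\<forall>\<^sub>F m in sequentially. continuous_on {s..} (\<lambda>t. \<Sum>i<m. dirichlet_term p x t i)"
    unfolding dirichlet_term_def
    by (intro always_eventually allI continuous_intros) (simp_all add: less_imp_neq[symmetric])
qed simp

text \<open>If there were finitely many zeros, those beyond \<open>l\<close> would lie to the right
  of \<open>\<sigma> k\<close> for all \<open>k \<ge> K\<close>. A sign change between two such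
  points produces a zero beyond \<open>l\<close> that is at most \<open>\<sigma> K\<close>.\<close>

lemma infinite_real_zerosI:
  fixes p x and \<sigma> :: "nat \<Rightarrow> real"
  defines "F \<equiv> \<lambda>t. \<Sum>n. dirichlet_term p x t n"
  assumes p: "\<And>n. p n \<ge> 1" "mono p"
    and \<sigma>: "decseq \<sigma>" "\<sigma> \<longlonglongrightarrow> l" "\<And>k. l < \<sigma> k"
    and summable: "\<And>k. summable (dirichlet_term p x (\<sigma> k))"
    and pos: "\<exists>\<^sub>\<infinity>k. 0 < F (\<sigma> k)" and neg: "\<exists>\<^sub>\<infinity>k. F (\<sigma> k) < 0"
  shows "infinite (real_zeros p x)"
proof
  assume fin: "finite (real_zeros p x)"
  have "\<forall>z\<in>real_zeros p x \<inter> {l<..}. \<forall>\<^sub>F k in sequentially. \<sigma> k < z"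
    using order_tendstoD(2)[OF \<sigma>(2)] by auto
  then have "\<forall>\<^sub>F k in sequentially. \<forall>z\<in>real_zeros p x \<inter> {l<..}. \<sigma> k < z"
    using fin by (simp add: eventually_ball_finite_distrib)
  then obtain K where K: "\<And>k z. k \<ge> K \<Longrightarrow> z \<in> real_zeros p x \<Longrightarrow> l < z \<Longrightarrow> \<sigma> k < z"
    unfolding eventually_sequentially by (metis IntI greaterThan_iff)
  obtain i where i: "i \<ge> K" "0 < F (\<sigma> i)" using pos unfolding INFM_nat_le by blast
  obtain j where j: "j \<ge> K" "F (\<sigma> j) < 0" using neg unfolding INFM_nat_le by blast
  have cont: "continuous_on {\<sigma> k..t} F" for k t
    unfolding F_def by (rule continuous_on_subset[OF dirichlet_continuous_on[OF p summable]]) auto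
  \<comment> \<open>Either of the two points may be the left one, so both forms of the intermediate
    value theorem occur.\<close>
  obtain z where z: "min (\<sigma> i) (\<sigma> j) \<le> z" "z \<le> max (\<sigma> i) (\<sigma> j)" "F z = 0"
  proof (cases "\<sigma> i \<le> \<sigma> j")
    case True
    then show ?thesis
      using IVT2'[of F "\<sigma> j" 0 "\<sigma> i", OF _ _ _ cont] i j that by auto
  next
    case False
    then show ?thesis
      using IVT'[of F "\<sigma> j" 0 "\<sigma> i", OF _ _ _ cont] i j that by auto
  qed
  have "summable (dirichlet_term p x z)"
    using z(1) dirichlet_summable_mono[OF p summable] by (metis min_le_iff_disj min_def)
  then have "z \<in> real_zeros p x"
    using z(3) summable_sums unfolding real_zeros_def F_def by fastforce
  moreover have "l < z" using z(1) \<sigma>(3)[of i] \<sigma>(3)[of j] by linarith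
  moreover have "z \<le> \<sigma> K"
    using z(2) decseqD[OF \<sigma>(1) i(1)] decseqD[OF \<sigma>(1) j(1)] by linarith
  ultimately show False using K[of K z] by auto
qed

text \<open>The head is at least its first term \<open>1 / p 0 powr t\<close>, and the tail is at
  most half of that. From \<open>N\<close> on, the partial sums stay above half the first term, and
  so does the limit.\<close>

lemma dirichlet_nonzero_of_dominant_head:
  assumes p: "\<And>n. p n > 0" "mono p" and N: "N \<ge> 1" "\<And>i. i < N \<Longrightarrow> x i = 1" and st: "s \<le> t"
    and tail: "\<And>m. \<bar>\<Sum>i<m. dirichlet_term p x s (N + i)\<bar> \<le> 1 / (2 * p 0 powr s)"
  shows "\<not> dirichlet_term p x t sums 0"
proof
  assume "dirichlet_term p x t sums 0"
  then have lim: "(\<lambda>m. \<Sum>i<m. dirichlet_term p x t i) \<longlonglongrightarrow> 0"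
    by (simp add: sums_def)
  have "1 / (2 * p 0 powr t) \<le> (\<Sum>i<N + m. dirichlet_term p x t i)" for m
  proof -
    have "1 / p 0 powr t \<le> (\<Sum>i<N. dirichlet_term p x t i)"
      using member_le_sum[of 0 "{..<N}" "dirichlet_term p x t"] N
      by (simp add: dirichlet_term_def)
    moreover have "\<bar>\<Sum>i<m. dirichlet_term p x t (N + i)\<bar> \<le> 1 / (2 * p 0 powr s) * p N powr (s - t)"
      by (rule dirichlet_tail_bound[OF p st tail])
    moreover have "1 / (2 * p 0 powr s) * p N powr (s - t) \<le> 1 / (2 * p 0 powr s) * p 0 powr (s - t)"
      using p st by (intro mult_left_mono powr_mono2') (auto simp: monoD)
    moreover have "1 / (2 * p 0 powr s) * p 0 powr (s - t) = 1 / (2 * p 0 powr t)"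
      using p(1)[of 0] by (simp add: powr_diff)
    moreover have "(\<Sum>i<N + m. dirichlet_term p x t i) =
        (\<Sum>i<N. dirichlet_term p x t i) + (\<Sum>i<m. dirichlet_term p x t (N + i))"
      by (induction m) simp_all
    ultimately show ?thesis by (simp add: abs_le_iff)
  qed
  then have "1 / (2 * p 0 powr t) \<le> 0"
    using LIMSEQ_ignore_initial_segment[OF lim, of N]
    by (intro LIMSEQ_le_const) (auto simp: add.commute)
  then show False using p(1)[of 0] by (simp add: divide_le_0_iff not_le)
qed

section \<open>Sign sequences, the sigma-algebras they generate, and independence\<close>

text \<open>The values are signs at every point and not just almost surely, so that finite sums are
  bounded pointwise and integrability follows from boundedness.\<close>

locale rademacher_sequence = prob_space M for M :: "'w measure" +
  fixes e :: "nat \<Rightarrow> 'w \<Rightarrow> real"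
  assumes sign: "e n \<omega> = 1 \<or> e n \<omega> = - 1"
    and indep: "indep_vars (\<lambda>_. borel) e UNIV"
    and half: "prob {\<omega> \<in> space M. e n \<omega> = 1} = 1 / 2"
begin

text \<open>\<open>gen {..<n}\<close> is the past before index \<open>n\<close> and
  \<open>gen {m..}\<close> the future from \<open>m\<close> on. As a measure space it can be the
  source in measurability statements; only its sets matter.\<close>

definition gen :: "nat set \<Rightarrow> 'w measure" where
  "gen I = sigma (space M) (\<Union>i\<in>I. {e i -` A \<inter> space M | A. A \<in> sets borel})"

lemma e_measurable [measurable]: "e n \<in> borel_measurable M"
  using indep by (auto simp: indep_vars_def2)

lemma space_gen [simp]: "space (gen I) = space M"
  by (simp add: gen_def space_measure_of_conv)

lemma sets_gen: "sets (gen I) = sigma_sets (space M) (\<Union>i\<in>I. {e i -` A \<inter> space M | A. A \<in> sets borel})"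
  unfolding gen_def by (rule sets_measure_of) auto

lemma sets_gen_mono: "I \<subseteq> J \<Longrightarrow> sets (gen I) \<subseteq> sets (gen J)"
  unfolding sets_gen by (intro sigma_sets_mono') auto

lemma sets_gen_events: "sets (gen I) \<subseteq> events"
  unfolding sets_gen by (intro sets.sigma_sets_subset) auto

lemma measurable_gen_mono: "f \<in> measurable (gen I) N \<Longrightarrow> I \<subseteq> J \<Longrightarrow> f \<in> measurable (gen J) N"
  using sets_gen_mono[of I J] by (auto simp: measurable_def)

lemma measurable_gen: "f \<in> measurable (gen I) N \<Longrightarrow> f \<in> measurable M N"
  using sets_gen_events[of I] by (auto simp: measurable_def)

lemma e_measurable_gen: "i \<in> I \<Longrightarrow> e i \<in> borel_measurable (gen I)"
  by (rule measurableI) (auto simp: sets_gen)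

text \<open>Preimages under a single variable are stable under intersection, which is what grouping
  an independent family into disjoint blocks requires.\<close>

lemma indep_set_gen:
  assumes "I \<inter> J = {}"
  shows "indep_set (sets (gen I)) (sets (gen J))"
proof -
  have "indep_sets (\<lambda>i. {e i -` A \<inter> space M | A. A \<in> sets borel}) (\<Union>b\<in>UNIV. case_bool I J b)"
    using indep unfolding indep_vars_def2 by (blast intro: indep_sets_mono_index[OF subset_UNIV])
  then have "indep_sets (\<lambda>b. sigma_sets (space M)
      (\<Union>i\<in>case_bool I J b. {e i -` A \<inter> space M | A. A \<in> sets borel})) UNIV"
  proof (rule indep_sets_collect_sigma)
    show "Int_stable {e i -` A \<inter> space M | A. A \<in> sets borel}" for i
      unfolding Int_stable_def
    proof safe
      fix A B :: "real set" assume "A \<in> sets borel" "B \<in> sets borel"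
      then show "\<exists>C. e i -` A \<inter> space M \<inter> (e i -` B \<inter> space M) = e i -` C \<inter> space M \<and> C \<in> sets borel"
        by (intro exI[of _ "A \<inter> B"]) auto
    qed
    show "disjoint_family_on (case_bool I J) UNIV"
      using assms by (auto simp: disjoint_family_on_def split: bool.splits)
  qed
  then show ?thesis
    unfolding indep_set_def sets_gen
    by (rule indep_sets_mono_sets) (auto split: bool.splits)
qed

lemma abs_e [simp]: "\<bar>e n \<omega>\<bar> = 1"
  using sign[of n \<omega>] by auto

lemma e_square [simp]: "(e n \<omega>)\<^sup>2 = 1"
  using sign[of n \<omega>] by auto

lemma integrable_bounded:
  fixes f :: "'w \<Rightarrow> real"
  assumes "f \<in> borel_measurable M" "\<And>\<omega>. \<bar>f \<omega>\<bar> \<le> B"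
  shows "integrable M f"
  using assms by (intro integrable_const_bound[where B = B]) auto

lemma expectation_e: "expectation (e n) = 0"
proof -
  let ?A = "{\<omega> \<in> space M. e n \<omega> = 1}"
  have A: "?A \<in> events" by measurable
  have "expectation (e n) = expectation (\<lambda>\<omega>. 2 * indicator ?A \<omega> - 1)"
    by (rule Bochner_Integration.integral_cong) (use sign[of n] in \<open>auto simp: indicator_def\<close>)
  also have "\<dots> = 2 * prob ?A - 1"
    using A by (subst Bochner_Integration.integral_diff) (auto simp: prob_space emeasure_eq_measure)
  finally show ?thesis by (simp add: half)
qed

text \<open>\<open>h\<close> depends only on signs other than \<open>e n\<close>, so the expectation
  factors, and \<open>e n\<close> is centred. This is why the cross terms in the moment computations
  vanish.\<close>

lemma expectation_mult_e:
  assumes h: "h \<in> borel_measurable (gen I)" and n: "n \<notin> I" and B: "\<And>\<omega>. \<bar>h \<omega>\<bar> \<le> B"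
  shows "expectation (\<lambda>\<omega>. h \<omega> * e n \<omega>) = 0"
proof -
  have hM: "h \<in> borel_measurable M"
    using h by (rule measurable_gen)
  have "indep_set (sets (gen I)) (sets (gen {n}))"
    using n by (intro indep_set_gen) auto
  moreover have "sigma_sets (space M) {h -` A \<inter> space M | A. A \<in> sets borel} \<subseteq> sets (gen I)"
  proof -
    have "{h -` A \<inter> space M | A. A \<in> sets borel} \<subseteq> sets (gen I)"
      using measurable_sets[OF h] by auto
    then show ?thesis
      using sets.sigma_sets_subset[of _ "gen I"] by simp
  qed
  moreover have "sigma_sets (space M) {e n -` A \<inter> space M | A. A \<in> sets borel} \<subseteq> sets (gen {n})"
    by (simp add: sets_gen)
  ultimately have "indep_set (sigma_sets (space M) {h -` A \<inter> space M | A. A \<in> sets borel})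
      (sigma_sets (space M) {e n -` A \<inter> space M | A. A \<in> sets borel})"
    unfolding indep_sets2_eq by (meson subset_iff)
  then have "indep_var borel h borel (e n)"
    unfolding indep_var_eq using hM e_measurable[of n] by blast
  moreover have "integrable M h"
    by (rule integrable_bounded[OF hM B])
  moreover have "integrable M (e n)"
    by (rule integrable_bounded[of _ 1]) auto
  ultimately have "expectation (\<lambda>\<omega>. h \<omega> * e n \<omega>) = expectation h * expectation (e n)"
    by (rule indep_var_lebesgue_integral)
  then show ?thesis by (simp add: expectation_e)
qed

lemma prefix_measurable: "{\<omega> \<in> space M. \<forall>i<k. e i \<omega> = 1} \<in> sets (gen {..<k})"
proof -
  have "{\<omega> \<in> space M. e i \<omega> = 1} \<in> sets (gen {..<k})" if "i < k" for i
  proof -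
    have "{\<omega> \<in> space M. e i \<omega> = 1} = e i -` {1} \<inter> space (gen {..<k})"
      by auto
    then show ?thesis
      using that by (simp only:) (intro measurable_sets[OF e_measurable_gen], auto)
  qed
  then have "{\<omega> \<in> space (gen {..<k}). \<forall>i\<in>{..<k}. e i \<omega> = 1} \<in> sets (gen {..<k})"
    by (intro sets.sets_Collect_finite_All) simp_all
  moreover have "{\<omega> \<in> space (gen {..<k}). \<forall>i\<in>{..<k}. e i \<omega> = 1} = {\<omega> \<in> space M. \<forall>i<k. e i \<omega> = 1}"
    by auto
  ultimately show ?thesis by (simp only:)
qed

text \<open>Each further sign halves the probability: the indicator of
  \<open>e n \<omega> = 1\<close> is \<open>(1 + e n \<omega>) / 2\<close>, and \<open>e n\<close>
  is orthogonal to the event about earlier signs.\<close>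

lemma prob_prefix_pos: "prob {\<omega> \<in> space M. \<forall>i<n. e i \<omega> = 1} > 0"
proof (induction n)
  case 0
  then show ?case by (simp add: prob_space)
next
  case (Suc n)
  define A where "A n = {\<omega> \<in> space M. \<forall>i<n. e i \<omega> = 1}" for n
  have ev: "A k \<in> events" for k
    using prefix_measurable sets_gen_events unfolding A_def by blast
  have ind: "(indicator (A n) :: 'w \<Rightarrow> real) \<in> borel_measurable (gen {..<n})"
    using prefix_measurable unfolding A_def by (rule borel_measurable_indicator)
  have split: "indicator (A (Suc n)) \<omega> =
      (1 / 2 :: real) * indicator (A n) \<omega> + (1 / 2) * (indicator (A n) \<omega> * e n \<omega>)" for \<omega>
  proof -
    have "\<omega> \<in> A (Suc n) \<longleftrightarrow> \<omega> \<in> A n \<and> e n \<omega> = 1"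
      unfolding A_def by (auto simp: less_Suc_eq)
    then show ?thesis
      using sign[of n \<omega>] by (auto simp: indicator_def)
  qed
  have int1: "integrable M (indicator (A n) :: 'w \<Rightarrow> real)"
    using ev[of n] by (simp add: emeasure_eq_measure)
  have int2: "integrable M (\<lambda>\<omega>. indicator (A n) \<omega> * e n \<omega>)"
    by (rule integrable_bounded[of _ 1]) (use ev[of n] in \<open>simp_all add: abs_mult indicator_def\<close>)
  have "prob (A (Suc n)) = expectation (indicator (A (Suc n)))"
    using ev[of "Suc n"] by simp
  also have "\<dots> = expectation (\<lambda>\<omega>. (1 / 2) * indicator (A n) \<omega> + (1 / 2) * (indicator (A n) \<omega> * e n \<omega>))"
    by (rule Bochner_Integration.integral_cong) (simp_all only: split)
  also have "\<dots> = (1 / 2) * prob (A n) + (1 / 2) * expectation (\<lambda>\<omega>. indicator (A n) \<omega> * e n \<omega>)"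
    using int1 int2 ev[of n] by (subst Bochner_Integration.integral_add) simp_all
  also have "expectation (\<lambda>\<omega>. indicator (A n) \<omega> * e n \<omega>) = 0"
    by (rule expectation_mult_e[OF ind, of _ 1]) (simp_all add: indicator_def)
  finally show ?case using Suc.IH by (simp add: A_def)
qed

section \<open>Kolmogorov's maximal inequality\<close>

text \<open>Freezing the partial sums at the first exceedance turns the maximal inequality into Chebyshev's.\<close>

primrec stopped :: "(nat \<Rightarrow> real) \<Rightarrow> nat \<Rightarrow> real \<Rightarrow> nat \<Rightarrow> 'w \<Rightarrow> real" where
  "stopped b N c 0 \<omega> = 0"
| "stopped b N c (Suc k) \<omega> = stopped b N c k \<omega> +
     (if \<bar>stopped b N c k \<omega>\<bar> < c then b k * e (N + k) \<omega> else 0)"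

lemma stopped_measurable: "stopped b N c k \<in> borel_measurable (gen {..<N + k})"
proof (induction k)
  case 0
  have "stopped b N c 0 = (\<lambda>\<omega>. 0)" by auto
  then show ?case by simp
next
  case (Suc k)
  have [measurable]: "stopped b N c k \<in> borel_measurable (gen {..<N + Suc k})"
    by (rule measurable_gen_mono[OF Suc]) auto
  have [measurable]: "e (N + k) \<in> borel_measurable (gen {..<N + Suc k})"
    by (rule e_measurable_gen) auto
  show ?case
    unfolding stopped.simps by measurable
qed

lemma stopped_bound: "\<bar>stopped b N c k \<omega>\<bar> \<le> (\<Sum>i<k. \<bar>b i\<bar>)"
proof (induction k)
  case (Suc k)
  have "\<bar>stopped b N c (Suc k) \<omega>\<bar> \<le> \<bar>stopped b N c k \<omega>\<bar> + \<bar>b k\<bar>"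
    using abs_triangle_ineq[of "stopped b N c k \<omega>" "b k * e (N + k) \<omega>"] by (simp add: abs_mult)
  with Suc show ?case by simp
qed simp

text \<open>By orthogonality, step \<open>k\<close> adds at most
  \<open>prob A * (b k)\<^sup>2\<close>. The past event \<open>A\<close> is carried along so that a
  tail can be controlled on the event that the first \<open>N\<close> signs are
  \<open>1\<close>.\<close>

lemma stopped_second_moment:
  assumes A: "A \<in> sets (gen {..<N})"
  shows "expectation (\<lambda>\<omega>. indicator A \<omega> * (stopped b N c k \<omega>)\<^sup>2) \<le> prob A * (\<Sum>i<k. (b i)\<^sup>2)"
proof (induction k)
  case (Suc k)
  let ?Y = "\<lambda>k \<omega>. stopped b N c k \<omega>"
  have AM: "A \<in> events" using A sets_gen_events by blast
  \<comment> \<open>The coefficient of \<open>e (N + k)\<close> in the expanded square; it depends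
    only on signs before \<open>N + k\<close>.\<close>
  define h where "h \<omega> = indicator A \<omega> * (if \<bar>?Y k \<omega>\<bar> < c then 2 * b k * ?Y k \<omega> else 0)" for \<omega>
  define B where "B = (\<Sum>i<k. \<bar>b i\<bar>)"
  have B: "\<bar>?Y k \<omega>\<bar> \<le> B" for \<omega>
    unfolding B_def by (rule stopped_bound)
  have B0: "B \<ge> 0" by (simp add: B_def sum_nonneg)
  have [measurable]: "?Y k \<in> borel_measurable (gen {..<N + k})"
    by (rule stopped_measurable)
  have [measurable]: "A \<in> sets (gen {..<N + k})"
    using A sets_gen_mono[of "{..<N}" "{..<N + k}"] by auto
  have hm: "h \<in> borel_measurable (gen {..<N + k})"
    unfolding h_def by measurable
  have hB: "\<bar>h \<omega>\<bar> \<le> 2 * \<bar>b k\<bar> * B" for \<omega>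
    using B[of \<omega>] B0 by (auto simp: h_def indicator_def abs_mult intro!: mult_left_mono)
  have YM: "?Y k \<in> borel_measurable M"
    by (rule measurable_gen[OF stopped_measurable])
  have int0: "integrable M (\<lambda>\<omega>. indicator A \<omega> * (?Y k \<omega>)\<^sup>2)"
  proof (rule integrable_bounded)
    show "(\<lambda>\<omega>. indicator A \<omega> * (?Y k \<omega>)\<^sup>2) \<in> borel_measurable M"
      using YM AM by measurable
    show "\<bar>indicator A \<omega> * (?Y k \<omega>)\<^sup>2\<bar> \<le> B\<^sup>2" for \<omega>
      using power_mono[OF B[of \<omega>], of 2] by (auto simp: indicator_def)
  qed
  have int1: "integrable M (\<lambda>\<omega>. h \<omega> * e (N + k) \<omega>)"
  proof (rule integrable_bounded)
    show "(\<lambda>\<omega>. h \<omega> * e (N + k) \<omega>) \<in> borel_measurable M"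
      using measurable_gen[OF hm] by measurable
    show "\<bar>h \<omega> * e (N + k) \<omega>\<bar> \<le> 2 * \<bar>b k\<bar> * B" for \<omega>
      using hB[of \<omega>] by (simp add: abs_mult)
  qed
  have int2: "integrable M (\<lambda>\<omega>. indicator A \<omega> * (b k)\<^sup>2)"
    using AM by (simp add: emeasure_eq_measure)
  \<comment> \<open>Equality holds while the sum still moves; once it is frozen, the last summand is
    surplus.\<close>
  have pt: "indicator A \<omega> * (?Y (Suc k) \<omega>)\<^sup>2 \<le>
      (indicator A \<omega> * (?Y k \<omega>)\<^sup>2 + h \<omega> * e (N + k) \<omega>) + indicator A \<omega> * (b k)\<^sup>2" for \<omega>
    by (simp add: h_def indicator_def power2_sum power_mult_distrib)
  have "expectation (\<lambda>\<omega>. indicator A \<omega> * (?Y (Suc k) \<omega>)\<^sup>2) \<le>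
    expectation (\<lambda>\<omega>. (indicator A \<omega> * (?Y k \<omega>)\<^sup>2 + h \<omega> * e (N + k) \<omega>) + indicator A \<omega> * (b k)\<^sup>2)"
    by (rule integral_mono_AE')
      (intro Bochner_Integration.integrable_add int0 int1 int2, use pt in blast,
        intro AE_I2 order.trans[OF _ pt], simp)
  also have "\<dots> = expectation (\<lambda>\<omega>. indicator A \<omega> * (?Y k \<omega>)\<^sup>2) + expectation (\<lambda>\<omega>. h \<omega> * e (N + k) \<omega>)
      + expectation (\<lambda>\<omega>. indicator A \<omega> * (b k)\<^sup>2)"
    using int0 int1 int2 by simp
  also have "expectation (\<lambda>\<omega>. h \<omega> * e (N + k) \<omega>) = 0"
    by (rule expectation_mult_e[OF hm _ hB]) simp
  also have "expectation (\<lambda>\<omega>. indicator A \<omega> * (b k)\<^sup>2) = prob A * (b k)\<^sup>2"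
    using AM by simp
  finally show ?case
    using Suc by (simp add: algebra_simps)
qed simp

text \<open>Up to the first exceedance the stopped sum follows the partial sums. At that moment it
  has reached the level \<open>c\<close>, and from then on it stays put.\<close>

lemma stopped_eq_or_exceeds:
  "if \<exists>j\<le>k. c \<le> \<bar>\<Sum>i<j. b i * e (N + i) \<omega>\<bar> then c \<le> \<bar>stopped b N c k \<omega>\<bar>
   else stopped b N c k \<omega> = (\<Sum>i<k. b i * e (N + i) \<omega>)"
proof (induction k)
  case (Suc k)
  show ?case
  proof (cases "\<exists>j\<le>k. c \<le> \<bar>\<Sum>i<j. b i * e (N + i) \<omega>\<bar>")
    case True
    then have "c \<le> \<bar>stopped b N c k \<omega>\<bar>" using Suc by simp
    then have "stopped b N c (Suc k) \<omega> = stopped b N c k \<omega>" by simp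
    moreover have "\<exists>j\<le>Suc k. c \<le> \<bar>\<Sum>i<j. b i * e (N + i) \<omega>\<bar>"
      using True le_SucI by blast
    ultimately show ?thesis using \<open>c \<le> \<bar>stopped b N c k \<omega>\<bar>\<close> by presburger
  next
    case False
    then have eq: "stopped b N c k \<omega> = (\<Sum>i<k. b i * e (N + i) \<omega>)" using Suc by simp
    then have "\<bar>stopped b N c k \<omega>\<bar> < c" using False by (metis le_refl not_le)
    then have "stopped b N c (Suc k) \<omega> = (\<Sum>i<Suc k. b i * e (N + i) \<omega>)"
      using eq by simp
    moreover have "(\<exists>j\<le>Suc k. c \<le> \<bar>\<Sum>i<j. b i * e (N + i) \<omega>\<bar>) \<longleftrightarrow>
        c \<le> \<bar>\<Sum>i<Suc k. b i * e (N + i) \<omega>\<bar>"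
      using False le_Suc_eq by blast
    ultimately show ?thesis by presburger
  qed
qed simp

text \<open>An exceedance at any time up to \<open>k\<close> is still visible in the stopped sum at
  time \<open>k\<close>, so Chebyshev's inequality at this single time suffices.\<close>

lemma maximal_inequality_finite:
  assumes A: "A \<in> sets (gen {..<N})" and c: "c > 0"
  shows "prob (A \<inter> {\<omega> \<in> space M. \<exists>j\<le>k. c \<le> \<bar>\<Sum>i<j. b i * e (N + i) \<omega>\<bar>})
    \<le> prob A * (\<Sum>i<k. (b i)\<^sup>2) / c\<^sup>2"
proof -
  let ?Y = "stopped b N c k"
  let ?E = "A \<inter> {\<omega> \<in> space M. \<exists>j\<le>k. c \<le> \<bar>\<Sum>i<j. b i * e (N + i) \<omega>\<bar>}"
  have AM [measurable]: "A \<in> events" using A sets_gen_events by blast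
  have YM [measurable]: "?Y \<in> borel_measurable M"
    by (rule measurable_gen[OF stopped_measurable])
  have EM: "?E \<in> events" by measurable
  have int: "integrable M (\<lambda>\<omega>. indicator A \<omega> * (?Y \<omega>)\<^sup>2)"
  proof (rule integrable_bounded)
    show "\<bar>indicator A \<omega> * (?Y \<omega>)\<^sup>2\<bar> \<le> (\<Sum>i<k. \<bar>b i\<bar>)\<^sup>2" for \<omega>
      using power_mono[OF stopped_bound, of b N c k \<omega> 2] by (auto simp: indicator_def)
  qed measurable
  have pt: "c\<^sup>2 * indicator ?E \<omega> \<le> indicator A \<omega> * (?Y \<omega>)\<^sup>2" for \<omega>
  proof (cases "\<omega> \<in> ?E")
    case True
    then have "c \<le> \<bar>?Y \<omega>\<bar>"
      using stopped_eq_or_exceeds[of k c b N \<omega>] by auto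
    then show ?thesis
      using True c power_mono[of c "\<bar>?Y \<omega>\<bar>" 2] by simp
  next
    case False
    then have "indicator ?E \<omega> = (0 :: real)" by (rule indicator_simps(2))
    then show ?thesis by (simp only:) simp
  qed
  have "c\<^sup>2 * prob ?E = expectation (\<lambda>\<omega>. c\<^sup>2 * indicator ?E \<omega>)"
    using EM by simp
  also have "\<dots> \<le> expectation (\<lambda>\<omega>. indicator A \<omega> * (?Y \<omega>)\<^sup>2)"
    by (rule integral_mono) (use EM int pt in \<open>auto simp: emeasure_eq_measure\<close>)
  also have "\<dots> \<le> prob A * (\<Sum>i<k. (b i)\<^sup>2)"
    by (rule stopped_second_moment[OF A])
  finally show ?thesis using c by (simp add: field_simps)
qed

text \<open>Continuity from below lets \<open>k\<close> tend to infinity. The factor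
  \<open>prob A\<close> makes this an estimate relative to \<open>A\<close>, useful however small
  \<open>prob A\<close> is.\<close>

lemma maximal_inequality:
  assumes A: "A \<in> sets (gen {..<N})" and c: "c > 0" and b: "summable (\<lambda>i. (b i)\<^sup>2)"
  shows "prob (A \<inter> {\<omega> \<in> space M. \<exists>j. c \<le> \<bar>\<Sum>i<j. b i * e (N + i) \<omega>\<bar>})
    \<le> prob A * (\<Sum>i. (b i)\<^sup>2) / c\<^sup>2"
proof -
  let ?E = "\<lambda>k. A \<inter> {\<omega> \<in> space M. \<exists>j\<le>k. c \<le> \<bar>\<Sum>i<j. b i * e (N + i) \<omega>\<bar>}"
  have AM [measurable]: "A \<in> events" using A sets_gen_events by blast
  have EM: "range ?E \<subseteq> events" by auto
  have "(\<lambda>k. prob (?E k)) \<longlonglongrightarrow> prob (\<Union>k. ?E k)"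
    by (rule finite_Lim_measure_incseq[OF EM]) (fastforce intro!: incseq_SucI simp: le_Suc_eq)
  moreover have "(\<Union>k. ?E k) = A \<inter> {\<omega> \<in> space M. \<exists>j. c \<le> \<bar>\<Sum>i<j. b i * e (N + i) \<omega>\<bar>}"
    by auto
  moreover have "prob (?E k) \<le> prob A * (\<Sum>i. (b i)\<^sup>2) / c\<^sup>2" for k
    using sum_le_suminf[OF b, of "{..<k}"]
    by (intro order.trans[OF maximal_inequality_finite[OF A c]] divide_right_mono mult_left_mono) auto
  ultimately show ?thesis
    by (intro LIMSEQ_le_const2[of "\<lambda>k. prob (?E k)"]) auto
qed

section \<open>Moments and anticoncentration of finite sign sums\<close>

lemma sum_measurable: "(\<lambda>\<omega>. \<Sum>i<n. a i * e i \<omega>) \<in> borel_measurable (gen {..<n})"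
  by (intro borel_measurable_sum borel_measurable_times borel_measurable_const e_measurable_gen)

lemma sum_bound: "\<bar>\<Sum>i<n. a i * e i \<omega>\<bar> \<le> (\<Sum>i<n. \<bar>a i\<bar>)"
  by (rule order.trans[OF sum_abs]) (simp add: abs_mult)

lemma sum_power_bound: "\<bar>(\<Sum>i<n. a i * e i \<omega>) ^ k\<bar> \<le> (\<Sum>i<n. \<bar>a i\<bar>) ^ k"
  unfolding power_abs by (intro power_mono sum_bound) simp

lemma integrable_sum_power: "integrable M (\<lambda>\<omega>. (\<Sum>i<n. a i * e i \<omega>) ^ k)"
  by (rule integrable_bounded[OF _ sum_power_bound]) measurable

lemma integrable_sum_power_e: "integrable M (\<lambda>\<omega>. (\<Sum>i<n. a i * e i \<omega>) ^ k * e n \<omega>)"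
  by (rule integrable_bounded[where B = "(\<Sum>i<n. \<bar>a i\<bar>) ^ k"])
    (measurable, simp add: abs_mult sum_power_bound)

lemma expectation_sum_power_e: "expectation (\<lambda>\<omega>. (\<Sum>i<n. a i * e i \<omega>) ^ k * e n \<omega>) = 0"
  by (rule expectation_mult_e[OF borel_measurable_power[OF sum_measurable] _ sum_power_bound]) simp

text \<open>In the expansion of \<open>(S n \<omega> + a n * e n \<omega>)^4\<close> the odd powers
  of the new sign have expectation \<open>0\<close>. The rest fits into
  \<open>3 * (V n + (a n)\<^sup>2)\<^sup>2\<close>, where only the coefficient of
  \<open>(a n)^4\<close> is generous.\<close>

lemma moments_sum:
  fixes a :: "nat \<Rightarrow> real"
  defines "S \<equiv> \<lambda>n \<omega>. \<Sum>i<n. a i * e i \<omega>" and "V \<equiv> \<lambda>n. \<Sum>i<n. (a i)\<^sup>2"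
  shows "expectation (\<lambda>\<omega>. S n \<omega>) = 0"
    and "expectation (\<lambda>\<omega>. (S n \<omega>)\<^sup>2) = V n"
    and "expectation (\<lambda>\<omega>. (S n \<omega>)^4) \<le> 3 * (V n)\<^sup>2"
proof -
  have int: "integrable M (\<lambda>\<omega>. S n \<omega> ^ k)" "integrable M (\<lambda>\<omega>. S n \<omega> ^ k * e n \<omega>)" for n k
    unfolding S_def by (rule integrable_sum_power integrable_sum_power_e)+
  have zero: "expectation (\<lambda>\<omega>. S n \<omega> ^ k * e n \<omega>) = 0" for n k
    unfolding S_def by (rule expectation_sum_power_e)
  have int1: "integrable M (S n)" "integrable M (\<lambda>\<omega>. S n \<omega> * e n \<omega>)" for n
    using int(1)[of n 1] int(2)[of n 1] by simp_all
  have zero1: "expectation (\<lambda>\<omega>. S n \<omega> * e n \<omega>) = 0" for n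
    using zero[of n 1] by simp
  have int_e: "integrable M (e n)" for n
    by (rule integrable_bounded[of _ 1]) auto
  have S_Suc: "S (Suc n) \<omega> = S n \<omega> + a n * e n \<omega>" for n \<omega>
    by (simp add: S_def)
  have S0: "S 0 \<omega> = 0" for \<omega> by (simp add: S_def)
  show "expectation (\<lambda>\<omega>. S n \<omega>) = 0"
    by (induction n) (simp_all add: S0 S_Suc int1 int_e expectation_e)
  have sq: "expectation (\<lambda>\<omega>. (S n \<omega>)\<^sup>2) = V n" for n
  proof (induction n)
    case (Suc n)
    have "(S (Suc n) \<omega>)\<^sup>2 = (S n \<omega>)\<^sup>2 + 2 * a n * (S n \<omega> * e n \<omega>) + (a n)\<^sup>2" for \<omega>
      by (simp add: S_Suc power2_sum power_mult_distrib)
    then show ?case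
      using Suc by (simp add: int int1 zero1 V_def prob_space)
  qed (simp add: S0 V_def)
  show "expectation (\<lambda>\<omega>. (S n \<omega>)\<^sup>2) = V n" by (rule sq)
  show "expectation (\<lambda>\<omega>. (S n \<omega>)^4) \<le> 3 * (V n)\<^sup>2"
  proof (induction n)
    case (Suc n)
    have "(S (Suc n) \<omega>)^4 = (S n \<omega>)^4 + 4 * a n * ((S n \<omega>)^3 * e n \<omega>) + 6 * (a n)\<^sup>2 * (S n \<omega>)\<^sup>2
      + 4 * (a n)^3 * (S n \<omega> * e n \<omega>) + (a n)^4" for \<omega>
      using sign[of n \<omega>] by (auto simp: S_Suc eval_nat_numeral algebra_simps)
    then have "expectation (\<lambda>\<omega>. (S (Suc n) \<omega>)^4) =
        expectation (\<lambda>\<omega>. (S n \<omega>)^4) + 6 * (a n)\<^sup>2 * V n + (a n)^4"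
      by (simp add: int int1 zero zero1 sq prob_space)
    also have "\<dots> \<le> 3 * (V n)\<^sup>2 + 6 * (a n)\<^sup>2 * V n + 3 * (a n)^4"
    proof -
      have "a n ^ 4 \<ge> 0" by simp
      then show ?thesis using Suc by linarith
    qed
    also have "\<dots> = 3 * (V (Suc n))\<^sup>2"
      by (simp add: V_def eval_nat_numeral algebra_simps)
    finally show ?case .
  qed (simp add: S0)
qed

text \<open>For the sum normalised to variance \<open>1\<close>, the left-hand side of
  \<open>quartic_minorant\<close> has expectation at least \<open>1 - 3 / 6 - 1 / 4 = 1 / 4\<close>,
  while the right-hand side has \<open>4 * prob ?E\<close>. The factor \<open>25\<close> makes
  \<open>L\<close> at most a fifth of the standard deviation.\<close>

lemma anticoncentration:
  assumes L: "L > 0" and V: "25 * L\<^sup>2 \<le> (\<Sum>i<n. (a i)\<^sup>2)"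
  shows "1 / 16 \<le> prob {\<omega> \<in> space M. L < (\<Sum>i<n. a i * e i \<omega>)}"
proof -
  define s where "s = sqrt (\<Sum>i<n. (a i)\<^sup>2)"
  define b where "b i = a i / s" for i
  define S where "S \<omega> = (\<Sum>i<n. b i * e i \<omega>)" for \<omega>
  have s5: "s \<ge> 5 * L"
    unfolding s_def using V L by (intro real_le_rsqrt) (simp add: power_mult_distrib)
  then have s: "s > 0" using L by linarith
  have s2: "s\<^sup>2 = (\<Sum>i<n. (a i)\<^sup>2)"
    by (simp add: s_def sum_nonneg)
  have b2: "(\<Sum>i<n. (b i)\<^sup>2) = 1"
    using s by (simp add: b_def power_divide flip: sum_divide_distrib s2)
  note m = moments_sum[of b n, folded S_def, unfolded b2]
  have int: "integrable M S" "integrable M (\<lambda>\<omega>. (S \<omega>)\<^sup>2)" "integrable M (\<lambda>\<omega>. (S \<omega>)^4)"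
    using integrable_sum_power[of b n 1] integrable_sum_power[of b n 2] integrable_sum_power[of b n 4]
    by (simp_all add: S_def[abs_def])
  have [measurable]: "S \<in> borel_measurable M" using int by simp
  let ?E = "{\<omega> \<in> space M. 1 / 5 < S \<omega>}"
  have E: "?E \<in> events" by measurable
  have "1 / 4 \<le> expectation (\<lambda>\<omega>. S \<omega> + (S \<omega>)^2 - (S \<omega>)^4 / 6 - 1 / 4)"
    using int m by (simp add: prob_space)
  also have "\<dots> \<le> expectation (\<lambda>\<omega>. 4 * indicator ?E \<omega>)"
  proof (rule integral_mono)
    show "integrable M (\<lambda>\<omega>. S \<omega> + (S \<omega>)^2 - (S \<omega>)^4 / 6 - 1 / 4)"
      using int by simp
    show "integrable M (\<lambda>\<omega>. 4 * indicator ?E \<omega> :: real)"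
      using E by (simp add: emeasure_eq_measure)
    show "S \<omega> + (S \<omega>)^2 - (S \<omega>)^4 / 6 - 1 / 4 \<le> 4 * indicator ?E \<omega>" if "\<omega> \<in> space M" for \<omega>
      using quartic_minorant[of "S \<omega>"] that by (simp add: indicator_def)
  qed
  also have "\<dots> = 4 * prob ?E" using E by simp
  finally have "1 / 16 \<le> prob ?E" by simp
  also have "\<dots> \<le> prob {\<omega> \<in> space M. L < (\<Sum>i<n. a i * e i \<omega>)}"
  proof (rule finite_measure_mono)
    have "L < (\<Sum>i<n. a i * e i \<omega>)" if "1 / 5 < S \<omega>" for \<omega>
    proof -
      have "S \<omega> = (\<Sum>i<n. a i * e i \<omega>) / s"
        by (simp add: S_def b_def sum_divide_distrib)
      then have "(\<Sum>i<n. a i * e i \<omega>) = s * S \<omega>"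
        using s by simp
      moreover have "s * (1 / 5) < s * S \<omega>"
        using that s by (rule mult_strict_left_mono)
      ultimately have "s / 5 < (\<Sum>i<n. a i * e i \<omega>)"
        by simp
      then show ?thesis using s5 by linarith
    qed
    then show "?E \<subseteq> {\<omega> \<in> space M. L < (\<Sum>i<n. a i * e i \<omega>)}" by auto
  qed measurable
  finally show ?thesis .
qed

section \<open>Almost sure unboundedness by the zero-one law\<close>

text \<open>For late \<open>k\<close> each level is exceeded with probability at least
  \<open>1 / 16\<close>, and this survives the limsup in \<open>k\<close> and the intersection over
  the levels. Dropping the first \<open>m\<close> terms moves all sums by at most one common
  constant, so the result is a tail event.\<close>

lemma AE_unbounded_above:
  fixes a :: "nat \<Rightarrow> nat \<Rightarrow> real"
  assumes conv: "\<And>k. AE \<omega> in M. summable (\<lambda>n. a k n * e n \<omega>)"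
    and bdd: "\<And>k n. \<bar>a k n\<bar> \<le> C n"
    and var: "\<And>L. \<forall>\<^sub>F k in sequentially. \<exists>m. L \<le> (\<Sum>n<m. (a k n)\<^sup>2)"
  shows "AE \<omega> in M. \<forall>L. \<exists>\<^sub>\<infinity>k. L < (\<Sum>n. a k n * e n \<omega>)"
proof -
  define T where "T k \<omega> = (\<Sum>n. a k n * e n \<omega>)" for k \<omega>
  have [measurable]: "T k \<in> borel_measurable M" for k
    unfolding T_def[abs_def] by measurable
  define G where "G L = {\<omega> \<in> space M. \<exists>\<^sub>\<infinity>k. real L < T k \<omega>}" for L :: nat
  have GM [measurable]: "G L \<in> events" for L
    unfolding G_def INFM_nat by measurable
  \<comment> \<open>The \<open>+ 1\<close> is a margin: a strict inequality between partial sums and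
    a level need not survive the limit.\<close>
  have "1 / 16 \<le> prob {\<omega> \<in> space M. real L < T k \<omega>}" if "25 * (real L + 1)\<^sup>2 \<le> (\<Sum>n<m. (a k n)\<^sup>2)" for L k m
  proof -
    let ?A = "\<lambda>m. {\<omega> \<in> space M. real L + 1 < (\<Sum>n<m. a k n * e n \<omega>)}"
    have AM: "?A m \<in> events" for m by measurable
    have "1 / 16 \<le> prob (?A m')" if "m \<le> m'" for m'
    proof (rule anticoncentration)
      have "(\<Sum>n<m. (a k n)\<^sup>2) \<le> (\<Sum>n<m'. (a k n)\<^sup>2)"
        using that by (intro sum_mono2) auto
      with \<open>25 * (real L + 1)\<^sup>2 \<le> _\<close> show "25 * (real L + 1)\<^sup>2 \<le> (\<Sum>n<m'. (a k n)\<^sup>2)" by linarith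
    qed simp
    then have "1 / 16 \<le> prob {\<omega> \<in> space M. \<exists>\<^sub>\<infinity>m. \<omega> \<in> ?A m}"
      by (intro prob_limsup_ge[OF AM]) (auto simp: eventually_sequentially)
    also have "\<dots> \<le> prob {\<omega> \<in> space M. real L < T k \<omega>}"
    proof (rule finite_measure_mono_AE)
      show "AE \<omega> in M. \<omega> \<in> {\<omega> \<in> space M. \<exists>\<^sub>\<infinity>m. \<omega> \<in> ?A m} \<longrightarrow> \<omega> \<in> {\<omega> \<in> space M. real L < T k \<omega>}"
        using conv[of k]
      proof eventually_elim
        case (elim \<omega>)
        then have lim: "(\<lambda>m. \<Sum>n<m. a k n * e n \<omega>) \<longlonglongrightarrow> T k \<omega>"
          unfolding T_def by (rule summable_LIMSEQ)
        have "real L < T k \<omega>" if "\<exists>\<^sub>\<infinity>m. real L + 1 < (\<Sum>n<m. a k n * e n \<omega>)"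
        proof (rule ccontr)
          assume "\<not> real L < T k \<omega>"
          then have "\<forall>\<^sub>F m in sequentially. (\<Sum>n<m. a k n * e n \<omega>) < real L + 1"
            by (intro order_tendstoD(2)[OF lim]) simp
          then show False
            using that unfolding frequently_def cofinite_eq_sequentially
            by (simp add: not_less eventually_mono less_imp_le)
        qed
        then show ?case by (auto elim: frequently_elim1)
      qed
    qed measurable
    finally show ?thesis .
  qed
  then have "\<forall>\<^sub>F k in sequentially. 1 / 16 \<le> prob {\<omega> \<in> space M. real L < T k \<omega>}" for L
    using var[of "25 * (real L + 1)\<^sup>2"] by (auto elim: eventually_mono)
  then have "1 / 16 \<le> prob {\<omega> \<in> space M. \<exists>\<^sub>\<infinity>k. \<omega> \<in> {\<omega> \<in> space M. real L < T k \<omega>}}" for L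
    by (intro prob_limsup_ge) measurable
  then have G16: "1 / 16 \<le> prob (G L)" for L
    by (simp add: G_def cong: conj_cong)
  have "(\<lambda>L. prob (G L)) \<longlonglongrightarrow> prob (\<Inter>L. G L)"
  proof (rule finite_Lim_measure_decseq)
    show "decseq G"
      unfolding decseq_def G_def by (auto elim: frequently_elim1)
  qed auto
  then have pos: "1 / 16 \<le> prob (\<Inter>L. G L)"
    using G16 by (intro LIMSEQ_le_const[of "\<lambda>L. prob (G L)"]) auto
  have "(\<Inter>L. G L) \<in> sets (gen {m..})" for m
  proof -
    define T' where "T' k \<omega> = (\<Sum>n. a k (n + m) * e (n + m) \<omega>)" for k \<omega>
    define D where "D = (\<Sum>n<m. C n)"
    \<comment> \<open>Required at every point, also where the series diverges, because tail events
      are compared as sets and not up to null sets.\<close>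
    have diff: "\<bar>T k \<omega> - T' k \<omega>\<bar> \<le> D" for k \<omega>
    proof (cases "summable (\<lambda>n. a k n * e n \<omega>)")
      case True
      have "T k \<omega> - T' k \<omega> = (\<Sum>n<m. a k n * e n \<omega>)"
        using suminf_split_initial_segment[OF True, of m] by (simp add: T_def T'_def)
      also have "\<bar>\<dots>\<bar> \<le> (\<Sum>n<m. \<bar>a k n\<bar>)" by (rule sum_bound)
      also have "\<dots> \<le> D" unfolding D_def by (intro sum_mono bdd)
      finally show ?thesis .
    next
      case False
      then have "\<not> summable (\<lambda>n. a k (n + m) * e (n + m) \<omega>)"
        using summable_iff_shift[of "\<lambda>n. a k n * e n \<omega>" m] by simp
      \<comment> \<open>for a divergent series \<open>suminf\<close> is a fixed junk value, insensitive to the shift\<close>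
      then have "(sums) (\<lambda>n. a k n * e n \<omega>) = (sums) (\<lambda>n. a k (n + m) * e (n + m) \<omega>)"
        using False unfolding summable_def by blast
      then have "T k \<omega> = T' k \<omega>"
        unfolding T_def T'_def suminf_def by simp
      moreover have "D \<ge> 0"
        unfolding D_def by (intro sum_nonneg order.trans[OF abs_ge_zero bdd[of 0]])
      ultimately show ?thesis by simp
    qed
    \<comment> \<open>A uniform distance \<open>D\<close> is absorbed by raising the level from
      \<open>L\<close> to some \<open>L'\<close> above \<open>L + D\<close>.\<close>
    have unbounded_transfer: "(\<forall>L::nat. \<exists>\<^sub>\<infinity>k. real L < f k) \<Longrightarrow> (\<And>k. \<bar>f k - g k\<bar> \<le> D) \<Longrightarrow> \<exists>\<^sub>\<infinity>k. real L < g k" for f g L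
    proof -
      assume f: "\<forall>L::nat. \<exists>\<^sub>\<infinity>k. real L < f k" and fg: "\<And>k. \<bar>f k - g k\<bar> \<le> D"
      obtain L' :: nat where "real L + D < real L'" using reals_Archimedean2 by blast
      moreover have "\<exists>\<^sub>\<infinity>k. real L' < f k" using f by blast
      ultimately show "\<exists>\<^sub>\<infinity>k. real L < g k"
        by (elim frequently_elim1) (use fg in \<open>smt (verit)\<close>)
    qed
    have "(\<forall>L::nat. \<exists>\<^sub>\<infinity>k. real L < T k \<omega>) \<longleftrightarrow> (\<forall>L::nat. \<exists>\<^sub>\<infinity>k. real L < T' k \<omega>)" for \<omega>
      using unbounded_transfer[of "\<lambda>k. T k \<omega>" "\<lambda>k. T' k \<omega>"] unbounded_transfer[of "\<lambda>k. T' k \<omega>" "\<lambda>k. T k \<omega>"] diff[of _ \<omega>]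
      by (metis abs_minus_commute)
    then have "(\<Inter>L. G L) = {\<omega> \<in> space (gen {m..}). \<forall>L::nat. \<exists>\<^sub>\<infinity>k. real L < T' k \<omega>}"
      by (auto simp: G_def)
    moreover have [measurable]: "e (n + m) \<in> borel_measurable (gen {m..})" for n
      by (rule e_measurable_gen) simp
    then have [measurable]: "T' k \<in> borel_measurable (gen {m..})" for k
      unfolding T'_def[abs_def] by measurable
    have "{\<omega> \<in> space (gen {m..}). \<forall>L::nat. \<exists>\<^sub>\<infinity>k. real L < T' k \<omega>} \<in> sets (gen {m..})"
      unfolding INFM_nat by measurable
    ultimately show ?thesis by simp
  qed
  moreover have "sets (gen {m..}) \<subseteq> sigma_sets (space M)
      (\<Union>i\<in>{m..}. sigma_sets (space M) {e i -` A \<inter> space M | A. A \<in> sets borel})" for m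
    unfolding sets_gen by (intro sigma_sets_subseteq UN_mono order_refl subsetI sigma_sets.Basic)
  ultimately have tail: "(\<Inter>L. G L) \<in> tail_events (\<lambda>i. sigma_sets (space M) {e i -` A \<inter> space M | A. A \<in> sets borel})"
    unfolding tail_events_def by blast
  have "prob (\<Inter>L. G L) = 0 \<or> prob (\<Inter>L. G L) = 1"
  proof (rule kolmogorov_0_1_law[OF _ _ tail])
    show "indep_sets (\<lambda>i. sigma_sets (space M) {e i -` A \<inter> space M | A. A \<in> sets borel}) UNIV"
      using indep unfolding indep_vars_def by blast
  qed (auto intro!: sigma_algebra_sigma_sets)
  then have "AE \<omega> in M. \<omega> \<in> (\<Inter>L. G L)"
    using pos by (intro AE_prob_1) auto
  then show ?thesis
  proof eventually_elim
    case (elim \<omega>)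
    show ?case
    proof
      fix L :: real
      obtain n :: nat where "L < real n" using reals_Archimedean2 by blast
      moreover have "\<exists>\<^sub>\<infinity>k. real n < T k \<omega>" using elim by (auto simp: G_def)
      ultimately show "\<exists>\<^sub>\<infinity>k. L < (\<Sum>n. a k n * e n \<omega>)"
        by (auto simp: T_def elim!: frequently_elim1)
    qed
  qed
qed

section \<open>Almost sure convergence and divergence of random sign series\<close>

text \<open>If the series diverges, then for some fixed level the sums started at any
  \<open>N\<close> reach that level. The maximal inequality bounds the probability of this for one
  \<open>N\<close> by the remaining variance over the squared level, which tends to
  \<open>0\<close>.\<close>

lemma AE_summable:
  assumes a: "summable (\<lambda>n. (a n)\<^sup>2)"
  shows "AE \<omega> in M. summable (\<lambda>n. a n * e n \<omega>)"
proof -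
  define E where "E c N = {\<omega> \<in> space M. \<exists>j. c \<le> \<bar>\<Sum>i<j. a (N + i) * e (N + i) \<omega>\<bar>}" for c N
  have EM [measurable]: "E c N \<in> events" for c N unfolding E_def by measurable
  have null: "prob (\<Inter>N. E c N) = 0" if c: "c > 0" for c
  proof -
    have "prob (\<Inter>N. E c N) \<le> (\<Sum>i. (a (i + N))\<^sup>2) / c\<^sup>2" for N
    proof -
      have "prob (\<Inter>N. E c N) \<le> prob (E c N)"
        by (intro finite_measure_mono) auto
      \<comment> \<open>Brings the event into the form of the maximal inequality, with the trivial
        past event \<open>space M\<close>.\<close>
      also have "E c N = space M \<inter> E c N" using sets.sets_into_space[OF EM] by auto
      also have "prob \<dots> \<le> prob (space M) * (\<Sum>i. (a (N + i))\<^sup>2) / c\<^sup>2"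
        unfolding E_def using c a
        by (intro maximal_inequality) (auto simp: add.commute summable_iff_shift[of "\<lambda>n. (a n)\<^sup>2"] intro: sets.top[of "gen {..<N}", simplified])
      finally show ?thesis by (simp add: prob_space add.commute)
    qed
    moreover have "(\<lambda>N. (\<Sum>i. (a (i + N))\<^sup>2) / c\<^sup>2) \<longlonglongrightarrow> 0"
      using suminf_exist_split2[OF a] by (intro tendsto_divide_zero)
    ultimately have "prob (\<Inter>N. E c N) \<le> 0"
      by (intro LIMSEQ_le_const[of "\<lambda>N. (\<Sum>i. (a (i + N))\<^sup>2) / c\<^sup>2"]) auto
    then show ?thesis using measure_nonneg[of M "\<Inter>N. E c N"] by linarith
  qed
  have "AE \<omega> in M. \<omega> \<notin> (\<Inter>N. E (1 / real (Suc k)) N)" for k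
    using null[of "1 / real (Suc k)"] by (intro AE_not_in) (auto simp: null_sets_def emeasure_eq_measure)
  then have "AE \<omega> in M. \<forall>k. \<omega> \<notin> (\<Inter>N. E (1 / real (Suc k)) N)"
    by (simp add: AE_all_countable)
  then show ?thesis
  proof (rule AE_mp, intro AE_I2 impI)
    fix \<omega> assume \<omega>: "\<omega> \<in> space M" and elim: "\<forall>k. \<omega> \<notin> (\<Inter>N. E (1 / real (Suc k)) N)"
    show "summable (\<lambda>n. a n * e n \<omega>)"
      unfolding summable_Cauchy
    proof (intro allI impI)
      fix r :: real assume r: "r > 0"
      \<comment> \<open>Half of \<open>r\<close>, because a block is the difference of two sums
        started at \<open>N\<close>.\<close>
      then obtain k where k: "inverse (real (Suc k)) < r / 2"
        using reals_Archimedean[of "r / 2"] by auto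
      obtain N where N: "\<And>j. \<bar>\<Sum>i<j. a (N + i) * e (N + i) \<omega>\<bar> < inverse (real (Suc k))"
        using elim[rule_format, of k] \<omega> by (auto simp: E_def not_le divide_inverse)
      have "norm (\<Sum>i\<in>{m..<n}. a i * e i \<omega>) < r" if "m \<ge> N" for m n
      proof (cases "m \<le> n")
        case True
        have split: "(\<Sum>i<q - N. a (N + i) * e (N + i) \<omega>) = (\<Sum>i\<in>{N..<q}. a i * e i \<omega>)" if "q \<ge> N" for q
          using sum.shift_bounds_nat_ivl[of "\<lambda>i. a i * e i \<omega>" 0 N "q - N"] that
          by (simp add: add.commute lessThan_atLeast0)
        have "(\<Sum>i\<in>{m..<n}. a i * e i \<omega>) = (\<Sum>i\<in>{N..<n}. a i * e i \<omega>) - (\<Sum>i\<in>{N..<m}. a i * e i \<omega>)"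
          using sum.atLeastLessThan_concat[of N m n "\<lambda>i. a i * e i \<omega>"] True that by simp
        then show ?thesis
          using N[of "n - N"] N[of "m - N"] split[of n] split[of m] True that k by simp
      qed (use r in simp)
      then show "\<exists>N. \<forall>m\<ge>N. \<forall>n. norm (\<Sum>i\<in>{m..<n}. a i * e i \<omega>) < r" by blast
    qed
  qed
qed

text \<open>Coefficients cut off at \<open>k\<close> form a family whose sums are the partial sums
  of the series and whose variances tend to infinity. Hence the partial sums are unbounded.\<close>

lemma AE_not_summable:
  assumes a: "\<not> summable (\<lambda>n. (a n)\<^sup>2)"
  shows "AE \<omega> in M. \<not> summable (\<lambda>n. a n * e n \<omega>)"
proof -
  define c where "c k n = (if n < k then a n else 0)" for k n :: nat
  have fin: "(\<lambda>n. c k n * e n \<omega>) sums (\<Sum>n<k. a n * e n \<omega>)" for k \<omega>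
    using sums_finite[of "{..<k}" "\<lambda>n. c k n * e n \<omega>"] by (simp add: c_def)
  have "AE \<omega> in M. \<forall>L. \<exists>\<^sub>\<infinity>k. L < (\<Sum>n. c k n * e n \<omega>)"
  proof (rule AE_unbounded_above)
    show "AE \<omega> in M. summable (\<lambda>n. c k n * e n \<omega>)" for k
      using fin by (auto simp: summable_def)
    show "\<bar>c k n\<bar> \<le> \<bar>a n\<bar>" for k n by (simp add: c_def)
    show "\<forall>\<^sub>F k in sequentially. \<exists>m. L \<le> (\<Sum>n<m. (c k n)\<^sup>2)" for L
    proof -
      obtain N where N: "L < (\<Sum>n<N. (a n)\<^sup>2)"
        using a summableI_nonneg_bounded[of "\<lambda>n. (a n)\<^sup>2" L] by (meson not_le zero_le_power2)
      have "L \<le> (\<Sum>n<N. (c k n)\<^sup>2)" if "k \<ge> N" for k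
        using N that by (simp add: c_def)
      then show ?thesis unfolding eventually_sequentially by blast
    qed
  qed
  then show ?thesis
  proof eventually_elim
    case (elim \<omega>)
    show ?case
    proof
      assume "summable (\<lambda>n. a n * e n \<omega>)"
      then have "Bseq (\<lambda>k. \<Sum>n<k. a n * e n \<omega>)"
        by (intro convergent_imp_Bseq) (simp add: summable_iff_convergent)
      then obtain K where K: "\<And>k. \<bar>\<Sum>n<k. a n * e n \<omega>\<bar> \<le> K"
        by (auto simp: Bseq_def)
      obtain k where "K < (\<Sum>n. c k n * e n \<omega>)"
        using frequently_ex[OF elim[rule_format, of K]] by blast
      then show False
        using K[of k] sums_unique[OF fin[of k \<omega>]] by simp
    qed
  qed
qed

section \<open>Random Dirichlet series: half-plane of convergence and real zeros\<close>

lemma dirichlet_term_e: "dirichlet_term p (\<lambda>n. e n \<omega>) s n = 1 / p n powr s * e n \<omega>"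
  by (simp add: dirichlet_term_def)

lemma AE_dirichlet_summable:
  assumes "summable (\<lambda>n. 1 / p n powr (2 * s))"
  shows "AE \<omega> in M. summable (dirichlet_term p (\<lambda>n. e n \<omega>) s)"
  using AE_summable[of "\<lambda>n. 1 / p n powr s"] assms
  unfolding dirichlet_term_e[abs_def] inverse_powr_square by blast

text \<open>Convergence at one point propagates to the right, so divergence at the countably many
  points \<open>l - inverse (real (Suc k))\<close> covers all \<open>s < l\<close>.\<close>

lemma AE_dirichlet_not_summable:
  assumes p: "\<And>n. p n \<ge> 1" "mono p"
    and div: "\<And>s. s < l \<Longrightarrow> \<not> summable (\<lambda>n. 1 / p n powr (2 * s))"
  shows "AE \<omega> in M. \<forall>s<l. \<not> summable (dirichlet_term p (\<lambda>n. e n \<omega>) s)"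
proof -
  have "AE \<omega> in M. \<not> summable (dirichlet_term p (\<lambda>n. e n \<omega>) (l - inverse (real (Suc k))))" for k
    using AE_not_summable[of "\<lambda>n. 1 / p n powr (l - inverse (real (Suc k)))"] div[of "l - inverse (real (Suc k))"]
    unfolding dirichlet_term_e[abs_def] inverse_powr_square by simp
  then have "AE \<omega> in M. \<forall>k. \<not> summable (dirichlet_term p (\<lambda>n. e n \<omega>) (l - inverse (real (Suc k))))"
    by (simp add: AE_all_countable)
  then show ?thesis
  proof eventually_elim
    case (elim \<omega>)
    show ?case
    proof (intro allI impI notI)
      fix s assume s: "s < l" and sm: "summable (dirichlet_term p (\<lambda>n. e n \<omega>) s)"
      obtain k where "inverse (real (Suc k)) < l - s"
        using reals_Archimedean[of "l - s"] s by auto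
      then show False
        using dirichlet_summable_mono[OF p sm, of "l - inverse (real (Suc k))"] elim by auto
    qed
  qed
qed

text \<open>For large \<open>N\<close> the tail variance is below \<open>c\<^sup>2\<close>, so the
  maximal inequality on the prefix event \<open>A\<close> gives \<open>prob B < prob A\<close>. On
  \<open>A - B\<close> the head dominates the tail.\<close>

lemma no_zeros_with_positive_probability:
  assumes p: "\<And>n. p n > 0" "mono p" and conv: "summable (\<lambda>n. 1 / p n powr (2 * s))"
  shows "\<exists>E\<in>events. prob E > 0 \<and> (\<forall>\<omega>\<in>E. \<forall>t\<ge>s. \<not> dirichlet_term p (\<lambda>n. e n \<omega>) t sums 0)"
proof -
  \<comment> \<open>Half of the first term at \<open>s\<close>, the tail size allowed by
    \<open>dirichlet_nonzero_of_dominant_head\<close>.\<close>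
  define c where "c = 1 / (2 * p 0 powr s)"
  have c: "c > 0" using p(1)[of 0] by (simp add: c_def)
  have "(\<lambda>N. \<Sum>i. 1 / p (i + N) powr (2 * s)) \<longlonglongrightarrow> 0"
    using suminf_exist_split2[OF conv] .
  then have "\<forall>\<^sub>F N in sequentially. (\<Sum>i. 1 / p (i + N) powr (2 * s)) < c\<^sup>2"
    using c by (intro order_tendstoD(2)) auto
  then have "\<forall>\<^sub>F N in sequentially. N \<ge> 1 \<and> (\<Sum>i. 1 / p (i + N) powr (2 * s)) < c\<^sup>2"
    using eventually_ge_at_top[of 1] by eventually_elim auto
  then obtain N where N: "N \<ge> 1" "(\<Sum>i. 1 / p (i + N) powr (2 * s)) < c\<^sup>2"
    by (auto simp: eventually_sequentially)
  define A where "A = {\<omega> \<in> space M. \<forall>i<N. e i \<omega> = 1}"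
  define B where "B = A \<inter> {\<omega> \<in> space M. \<exists>j. c \<le> \<bar>\<Sum>i<j. 1 / p (N + i) powr s * e (N + i) \<omega>\<bar>}"
  have A: "A \<in> sets (gen {..<N})" unfolding A_def by (rule prefix_measurable)
  then have AM [measurable]: "A \<in> events" using sets_gen_events by blast
  have BM: "B \<in> events" unfolding B_def by measurable
  have sq: "(1 / p (N + i) powr s)\<^sup>2 = 1 / p (i + N) powr (2 * s)" for i
    by (simp add: inverse_powr_square add.commute)
  have "prob B \<le> prob A * (\<Sum>i. (1 / p (N + i) powr s)\<^sup>2) / c\<^sup>2"
    unfolding B_def
  proof (rule maximal_inequality[OF A c])
    show "summable (\<lambda>i. (1 / p (N + i) powr s)\<^sup>2)"
      unfolding sq using conv by (rule summable_ignore_initial_segment)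
  qed
  also have "\<dots> < prob A"
    using N(2) c prob_prefix_pos[of N] unfolding sq A_def[symmetric]
    by (simp add: divide_less_eq)
  also have "prob A - prob B = prob (A - B)"
    using AM BM by (intro finite_measure_Diff[symmetric]) (auto simp: B_def)
  finally have "prob (A - B) > 0"
    using finite_measure_Diff[OF AM BM] by (simp add: B_def)
  moreover have "\<not> dirichlet_term p (\<lambda>n. e n \<omega>) t sums 0" if "\<omega> \<in> A - B" "s \<le> t" for \<omega> t
  proof (rule dirichlet_nonzero_of_dominant_head[OF p N(1) _ that(2)])
    show "e i \<omega> = 1" if "i < N" for i using that \<open>\<omega> \<in> A - B\<close> by (auto simp: A_def)
    show "\<bar>\<Sum>i<m. dirichlet_term p (\<lambda>n. e n \<omega>) s (N + i)\<bar> \<le> 1 / (2 * p 0 powr s)" for m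
      using \<open>\<omega> \<in> A - B\<close> sets.sets_into_space[OF AM]
      unfolding B_def c_def[symmetric] dirichlet_term_e by (auto simp: not_le intro: less_imp_le)
  qed
  ultimately show ?thesis using AM BM by (intro bexI[of _ "A - B"]) auto
qed

text \<open>The values at points decreasing to \<open>l\<close> are sign series whose variances tend
  to infinity. Unboundedness makes infinitely many of them positive; applied to the negated
  coefficients, it makes infinitely many negative.\<close>

lemma AE_infinite_real_zeros:
  assumes p: "\<And>n. p n \<ge> 1" "mono p"
    and conv: "\<And>s. s > l \<Longrightarrow> summable (\<lambda>n. 1 / p n powr (2 * s))"
    and div: "\<not> summable (\<lambda>n. 1 / p n powr (2 * l))"
  shows "AE \<omega> in M. infinite (real_zeros p (\<lambda>n. e n \<omega>))"
proof -
  define \<sigma> where "\<sigma> k = l + inverse (real (Suc k))" for k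
  have \<sigma>: "decseq \<sigma>" "\<sigma> \<longlonglongrightarrow> l" "l < \<sigma> k" for k
    using LIMSEQ_inverse_real_of_nat_add[of l]
    by (auto simp: \<sigma>_def[abs_def] decseq_def le_imp_inverse_le)
  have p0: "p n > 0" for n using p(1)[of n] by linarith
  have sm: "AE \<omega> in M. summable (dirichlet_term p (\<lambda>n. e n \<omega>) (\<sigma> k))" for k
    by (rule AE_dirichlet_summable[OF conv[OF \<sigma>(3)]])
  \<comment> \<open>Divergence at \<open>l\<close> shows in a finite sum, which is continuous in the
    exponent and so stays large at \<open>\<sigma> k\<close> for late \<open>k\<close>.\<close>
  have var: "\<forall>\<^sub>F k in sequentially. \<exists>m. L \<le> (\<Sum>n<m. (1 / p n powr \<sigma> k)\<^sup>2)" for L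
  proof -
    obtain N where N: "L < (\<Sum>n<N. 1 / p n powr (2 * l))"
      using div summableI_nonneg_bounded[of "\<lambda>n. 1 / p n powr (2 * l)" L]
      by (meson not_le powr_ge_zero zero_le_divide_1_iff)
    have "(\<lambda>k. \<Sum>n<N. 1 / p n powr (2 * \<sigma> k)) \<longlonglongrightarrow> (\<Sum>n<N. 1 / p n powr (2 * l))"
      using p0 by (intro tendsto_intros \<sigma>(2)) (simp_all add: less_imp_neq[symmetric])
    then have "\<forall>\<^sub>F k in sequentially. L < (\<Sum>n<N. 1 / p n powr (2 * \<sigma> k))"
      by (rule order_tendstoD(1)[OF _ N])
    then show ?thesis
      by eventually_elim (auto simp: inverse_powr_square intro: less_imp_le)
  qed
  \<comment> \<open>The bound must not depend on \<open>k\<close>, since it controls the effect of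
    finitely many signs on all values at once.\<close>
  have bdd: "\<bar>1 / p n powr \<sigma> k\<bar> \<le> p n powr (- l)" for k n
  proof -
    have "p n powr (- \<sigma> k) \<le> p n powr (- l)"
      using p(1)[of n] \<sigma>(3)[of k] by (intro powr_mono) auto
    then show ?thesis by (simp add: powr_minus_divide)
  qed
  have "AE \<omega> in M. \<forall>L. \<exists>\<^sub>\<infinity>k. L < (\<Sum>n. 1 / p n powr \<sigma> k * e n \<omega>)"
    by (rule AE_unbounded_above[OF _ bdd var]) (rule sm[unfolded dirichlet_term_e[abs_def]])
  moreover have "AE \<omega> in M. \<forall>L. \<exists>\<^sub>\<infinity>k. L < (\<Sum>n. - (1 / p n powr \<sigma> k) * e n \<omega>)"
  proof (rule AE_unbounded_above)
    show "AE \<omega> in M. summable (\<lambda>n. - (1 / p n powr \<sigma> k) * e n \<omega>)" for k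
      using sm[unfolded dirichlet_term_e[abs_def], of k] summable_minus by (auto simp: minus_mult_left)
  qed (use bdd var in auto)
  moreover have "AE \<omega> in M. \<forall>k. summable (dirichlet_term p (\<lambda>n. e n \<omega>) (\<sigma> k))"
    using sm by (simp add: AE_all_countable)
  ultimately show ?thesis
  proof eventually_elim
    case (elim \<omega>)
    have "(\<Sum>n. - (1 / p n powr \<sigma> k) * e n \<omega>) = - (\<Sum>n. dirichlet_term p (\<lambda>n. e n \<omega>) (\<sigma> k) n)" for k
      using suminf_minus[of "dirichlet_term p (\<lambda>n. e n \<omega>) (\<sigma> k)"] elim(3) by (simp add: dirichlet_term_e)
    then have neg: "\<exists>\<^sub>\<infinity>k. (\<Sum>n. dirichlet_term p (\<lambda>n. e n \<omega>) (\<sigma> k) n) < 0"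
      using elim(2)[rule_format, of 0] by simp
    have pos: "\<exists>\<^sub>\<infinity>k. 0 < (\<Sum>n. dirichlet_term p (\<lambda>n. e n \<omega>) (\<sigma> k) n)"
      using elim(1) by (simp add: dirichlet_term_e)
    show ?case
      using infinite_real_zerosI[OF p \<sigma> _ pos neg] elim(3) by blast
  qed
qed

end

section \<open>Passage to variables that are signs everywhere, and the two cases\<close>

theorem theorem1p1:
  fixes p :: "nat \<Rightarrow> real"
    and M :: "'w measure"
    and X :: "nat \<Rightarrow> 'w \<Rightarrow> real"
  assumes p_incr: "strict_mono p"
    and p_pos: "\<And>n. p n > 0"
    and P1: "range p \<inter> {0..<1} = {}"
    and P2: "has_abscissa_of_convergence p (\<lambda>n. 1) 1"
    and M: "prob_space M"
    and X_indep: "prob_space.indep_vars M (\<lambda>_. borel) X UNIV"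
    and X_plus: "\<And>n. measure M {\<omega> \<in> space M. X n \<omega> = 1} = 1 / 2"
    and X_minus: "\<And>n. measure M {\<omega> \<in> space M. X n \<omega> = - 1} = 1 / 2"
  shows "(summable (\<lambda>n. 1 / p n) \<longrightarrow>
            (\<exists>E \<in> sets M. measure M E > 0 \<and>
               (\<forall>\<omega>\<in>E. real_zeros p (\<lambda>n. X n \<omega>) = {})))
       \<and> (\<not> summable (\<lambda>n. 1 / p n) \<longrightarrow>
            (AE \<omega> in M. infinite (real_zeros p (\<lambda>n. X n \<omega>))))"
proof -
  interpret prob_space M by (rule M)
  \<comment> \<open>Differs from \<open>X\<close> only on a null set, and inherits independence as a
    measurable function of each \<open>X n\<close>.\<close>
  define e :: "nat \<Rightarrow> 'w \<Rightarrow> real" where "e n \<omega> = (if X n \<omega> = 1 then 1 else - 1)" for n \<omega>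
  have X [measurable]: "X n \<in> borel_measurable M" for n
    using X_indep by (auto simp: indep_vars_def2)
  interpret rademacher_sequence M e
  proof
    show "e n \<omega> = 1 \<or> e n \<omega> = - 1" for n \<omega> by (simp add: e_def)
    show "indep_vars (\<lambda>_. borel) e UNIV"
      unfolding e_def[abs_def] by (rule indep_vars_compose2[OF X_indep]) measurable
    show "prob {\<omega> \<in> space M. e n \<omega> = 1} = 1 / 2" for n
    proof -
      have "{\<omega> \<in> space M. e n \<omega> = 1} = {\<omega> \<in> space M. X n \<omega> = 1}"
        by (auto simp: e_def)
      then show ?thesis by (simp add: X_plus)
    qed
  qed
  have "AE \<omega> in M. X n \<omega> = e n \<omega>" for n
  proof -
    have "prob ({\<omega> \<in> space M. X n \<omega> = 1} \<union> {\<omega> \<in> space M. X n \<omega> = - 1}) = 1"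
      by (subst finite_measure_Union) (auto simp: X_plus X_minus)
    then have "AE \<omega> in M. \<omega> \<in> {\<omega> \<in> space M. X n \<omega> = 1} \<union> {\<omega> \<in> space M. X n \<omega> = - 1}"
      by (rule AE_prob_1)
    then show ?thesis by eventually_elim (auto simp: e_def)
  qed
  then have X_eq: "AE \<omega> in M. (\<lambda>n. X n \<omega>) = (\<lambda>n. e n \<omega>)"
    by (simp add: fun_eq_iff AE_all_countable)
  have mono: "mono p" by (rule strict_mono_mono[OF p_incr])
  have p1: "p n \<ge> 1" for n
  proof (rule ccontr)
    assume "\<not> p n \<ge> 1"
    then have "p n \<in> range p \<inter> {0..<1}"
      using p_pos[of n] by auto
    then show False using P1 by blast
  qed
  have conv: "summable (\<lambda>n. 1 / p n powr (2 * s))" if "s > 1 / 2" for s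
    using P2 that by (simp add: has_abscissa_of_convergence_def dirichlet_term_def[abs_def])
  \<comment> \<open>Convergence at \<open>2 * s\<close> would propagate to the right and force the
    abscissa down to at most \<open>2 * s\<close>.\<close>
  have div: "\<not> summable (\<lambda>n. 1 / p n powr (2 * s))" if "s < 1 / 2" for s
  proof
    assume "summable (\<lambda>n. 1 / p n powr (2 * s))"
    then have "summable (dirichlet_term p (\<lambda>n. 1) (2 * s))"
      by (simp add: dirichlet_term_def[abs_def])
    then have "\<forall>t>2 * s. summable (dirichlet_term p (\<lambda>n. 1) t)"
      using dirichlet_summable_mono[OF p1 mono] by (meson less_imp_le)
    then have "1 \<le> 2 * s"
      using P2 unfolding has_abscissa_of_convergence_def by blast
    then show False using that by simp
  qed
  have half_eq: "(\<lambda>n. 1 / p n powr (2 * (1 / 2))) = (\<lambda>n. 1 / p n)"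
    using p_pos by (simp add: abs_of_pos)
  show ?thesis
  proof (intro conjI impI)
    assume "summable (\<lambda>n. 1 / p n)"
    then obtain E where E: "E \<in> events" "prob E > 0"
      and nz: "\<And>\<omega> t. \<omega> \<in> E \<Longrightarrow> t \<ge> 1 / 2 \<Longrightarrow> \<not> dirichlet_term p (\<lambda>n. e n \<omega>) t sums 0"
      using no_zeros_with_positive_probability[OF p_pos mono, of "1 / 2", unfolded half_eq] by blast
    \<comment> \<open>A zero presupposes convergence, so almost surely there are none to the left of
      \<open>1 / 2\<close>.\<close>
    have "AE \<omega> in M. (\<lambda>n. X n \<omega>) = (\<lambda>n. e n \<omega>) \<and> (\<forall>s<1 / 2. \<not> summable (dirichlet_term p (\<lambda>n. e n \<omega>) s))"
      by (rule eventually_conj[OF X_eq AE_dirichlet_not_summable[OF p1 mono div]])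
    \<comment> \<open>Removing the null set \<open>N\<close> from \<open>E\<close> costs no
      probability and leaves an event on which both almost sure properties hold at every
      point.\<close>
    then obtain N where N: "N \<in> null_sets M"
      and good: "{\<omega> \<in> space M. \<not> ((\<lambda>n. X n \<omega>) = (\<lambda>n. e n \<omega>) \<and>
          (\<forall>s<1 / 2. \<not> summable (dirichlet_term p (\<lambda>n. e n \<omega>) s)))} \<subseteq> N"
      unfolding eventually_ae_filter by blast
    have "real_zeros p (\<lambda>n. X n \<omega>) = {}" if \<omega>: "\<omega> \<in> E - N" for \<omega>
    proof -
      have "\<omega> \<in> space M" using \<omega> sets.sets_into_space[OF E(1)] by auto
      then have eq: "(\<lambda>n. X n \<omega>) = (\<lambda>n. e n \<omega>)"
        and ns: "\<And>s. s < 1 / 2 \<Longrightarrow> \<not> summable (dirichlet_term p (\<lambda>n. e n \<omega>) s)"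
        using good \<omega> by blast+
      have "\<not> dirichlet_term p (\<lambda>n. e n \<omega>) s sums 0" for s
        using nz[of \<omega> s] ns[of s] \<omega> by (cases "s < 1 / 2") (auto simp: summable_def)
      then show ?thesis unfolding real_zeros_def eq by simp
    qed
    moreover have "prob (E - N) = prob E"
      using E N by (simp add: measure_Diff_null_set)
    ultimately show "\<exists>E\<in>events. 0 < prob E \<and> (\<forall>\<omega>\<in>E. real_zeros p (\<lambda>n. X n \<omega>) = {})"
      using E N by (intro bexI[of _ "E - N"]) auto
  next
    assume "\<not> summable (\<lambda>n. 1 / p n)"
    then have "AE \<omega> in M. infinite (real_zeros p (\<lambda>n. e n \<omega>))"
      by (intro AE_infinite_real_zeros[OF p1 mono conv, of "1 / 2"]) (simp_all only: half_eq not_False_eq_True)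
    with X_eq show "AE \<omega> in M. infinite (real_zeros p (\<lambda>n. X n \<omega>))"
      by eventually_elim simp
  qed
qed

end
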